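(* Let $G$ and $G'$ be two graphs on the same vertex set $V$ (possibly infinite), and let $k$ be an integer with $k\geq 4$, $k\equiv 0\pmod 4$, and $k\leq |V|-2$ (the latter condition being void if $V$ is infinite). Then the following are equivalent: (i) for every $k$-element subset $K$ of $V$, $e(G_{\restriction K})$ and $e(G'_{\restriction K})$ have the same parity; (ii) $G'=G$ or $G'=\overline G$.
   Context: A graph is a pair $G=(V,E)$ with $E$ a set of 2-element subsets of $V$; $\overline G$ denotes its complement, $G_{\restriction K}$ the subgraph induced on $K\subseteq V$, and $e(H)$ the number of edges of a graph $H$. *)

theory Defs
  imports Main "HOL-Library.Ramsey"
begin

type_synonym 'a graph = "'a set \<times> 'a set set"

abbreviation verts :: "'a graph \<Rightarrow> 'a set" where
  "verts G \<equiv> fst G"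

abbreviation edges :: "'a graph \<Rightarrow> 'a set set" where
  "edges G \<equiv> snd G"

text \<open>The vertex set may be infinite or empty.\<close>

definition is_graph :: "'a graph \<Rightarrow> bool" where
  "is_graph G \<longleftrightarrow> edges G \<subseteq> [verts G]\<^bsup>2\<^esup>"

definition complement_graph :: "'a graph \<Rightarrow> 'a graph" where
  "complement_graph G = (verts G, [verts G]\<^bsup>2\<^esup> - edges G)"

text \<open>Meant for \<open>K \<subseteq> verts G\<close> only.\<close>

definition induced_subgraph :: "'a graph \<Rightarrow> 'a set \<Rightarrow> 'a graph" where
  "induced_subgraph G K = (K, {e \<in> edges G. e \<subseteq> K})"

text \<open>Used only for graphs with finitely many edges (\<^const>\<open>card\<close> is 0 on infinite sets).\<close>

definition edge_count :: "'a graph \<Rightarrow> nat" where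
  "edge_count H = card (edges H)"

end

theory Submission
  imports Defs
begin

text \<open>Let \<open>D\<close> be the symmetric difference of the two edge sets; (i) says that every \<open>k\<close>-set spans
  an even number of edges of \<open>D\<close>. Exchanging one vertex of a \<open>k\<close>-set shows that any two vertices
  \<open>a, b\<close> have the same degree modulo 2 into every \<open>(k-1)\<close>-set \<open>T\<close> avoiding them; exchanging one
  vertex \<open>c\<close> of \<open>T\<close> for \<open>d\<close> shows that whether \<open>a\<close> and \<open>b\<close> agree at \<open>c\<close> does not depend on \<open>c\<close>.
  Were they to disagree everywhere, their degrees into \<open>T\<close> would add up to the odd number \<open>k-1\<close>.
  So \<open>a\<close> and \<open>b\<close> agree everywhere, and \<open>D\<close> is empty or complete. Conversely, \<open>k\<close> divisible by 4
  makes \<open>k choose 2\<close> even.\<close>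

lemma ex_nset:
  assumes "finite A \<longrightarrow> n \<le> card A"
  shows "\<exists>T \<subseteq> A. finite T \<and> card T = n"
proof (cases "finite A")
  case True
  with assms show ?thesis
    by (meson obtain_subset_with_card_n)
next
  case False
  then show ?thesis
    using infinite_arbitrarily_large[of A n] by blast
qed

lemma finite_edges_within:
  assumes "D \<subseteq> [V]\<^bsup>2\<^esup>" "finite K"
  shows "finite {e \<in> D. e \<subseteq> K}"
  by (rule finite_subset[of _ "Pow K"]) (use assms in auto)

text \<open>An edge of \<open>D\<close> inside \<open>insert a T\<close> either avoids
  \<open>a\<close> or is \<open>{a, x}\<close> for a unique \<open>x\<close> in \<open>T\<close>;
  since edges have two elements, \<open>{a}\<close> itself cannot occur.\<close>

lemma card_edges_within_insert:
  assumes D: "D \<subseteq> [V]\<^bsup>2\<^esup>" and "finite T" "a \<notin> T"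
  shows "card {e \<in> D. e \<subseteq> insert a T} = card {e \<in> D. e \<subseteq> T} + card {x \<in> T. {a, x} \<in> D}"
proof -
  have split: "{e \<in> D. e \<subseteq> insert a T} = {e \<in> D. e \<subseteq> T} \<union> (\<lambda>x. {a, x}) ` {x \<in> T. {a, x} \<in> D}"
  proof (intro equalityI subsetI)
    fix e assume e: "e \<in> {e \<in> D. e \<subseteq> insert a T}"
    then have "e \<in> [V]\<^bsup>2\<^esup>" using D by auto
    then obtain u v where "e = {u, v}" "u \<noteq> v"
      by (auto simp: nsets_def card_2_iff)
    with e show "e \<in> {e \<in> D. e \<subseteq> T} \<union> (\<lambda>x. {a, x}) ` {x \<in> T. {a, x} \<in> D}"
      by (auto simp: insert_commute)
  qed auto
  have "card {e \<in> D. e \<subseteq> insert a T} =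
    card {e \<in> D. e \<subseteq> T} + card ((\<lambda>x. {a, x}) ` {x \<in> T. {a, x} \<in> D})"
    unfolding split
    by (rule card_Un_disjoint) (use assms finite_edges_within[OF D] in auto)
  also have "card ((\<lambda>x. {a, x}) ` {x \<in> T. {a, x} \<in> D}) = card {x \<in> T. {a, x} \<in> D}"
    by (rule card_image) (auto simp: inj_on_def doubleton_eq_iff)
  finally show ?thesis .
qed

text \<open>Used with \<open_free> removed: adding \<open>c\<close> to \<open>T\<close> flips the
  parity of a degree into \<open>T\<close> exactly when \<open>c\<close> is a neighbour.\<close>

lemma even_card_filter_insert:
  assumes "finite T" "c \<notin> T"
  shows "even (card {x \<in> insert c T. P x}) \<longleftrightarrow> (even (card {x \<in> T. P x}) \<longleftrightarrow> \<not> P c)"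
proof -
  have "{x \<in> insert c T. P x} = (if P c then insert c {x \<in> T. P x} else {x \<in> T. P x})"
    by auto
  with assms show ?thesis by simp
qed

lemma even_induced_imp_empty_or_complete:
  assumes D: "D \<subseteq> [V]\<^bsup>2\<^esup>" and k: "even k" "k \<ge> 2"
    and V: "finite V \<longrightarrow> k + 2 \<le> card V"
    and even_within: "\<And>K. K \<in> [V]\<^bsup>k\<^esup> \<Longrightarrow> even (card {e \<in> D. e \<subseteq> K})"
  shows "D = {} \<or> D = [V]\<^bsup>2\<^esup>"
proof -
  let ?deg = "\<lambda>T a. card {x \<in> T. {a, x} \<in> D}"
  have deg_eq: "even (?deg T a) \<longleftrightarrow> even (?deg T b)"
    if T: "T \<subseteq> V" "finite T" "card T = k - 1" and "a \<in> V - T" "b \<in> V - T" for T a b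
  proof -
    \<comment> \<open>The sum counts the edges of \<open>D\<close> in the \<open>k\<close>-set
      \<open>insert z T\<close>. Its first term does not depend on \<open>z\<close>, so it cancels
      when \<open>a\<close> and \<open>b\<close> are compared.\<close>
    have "even (card {e \<in> D. e \<subseteq> T} + ?deg T z)" if "z \<in> V - T" for z
    proof -
      have "insert z T \<in> [V]\<^bsup>k\<^esup>"
        using T that k by (auto simp: nsets_def)
      then show ?thesis
        using even_within card_edges_within_insert[OF D, of T z] T that by fastforce
    qed
    from this[of a] this[of b] show ?thesis using that by simp
  qed
  \<comment> \<open>For \<open>card F = 4\<close> this leaves \<open>k - 2\<close> further vertices,
    for \<open>card F = 3\<close> it leaves \<open>k - 1\<close>.\<close>
  have room: "\<exists>T \<subseteq> V - F. finite T \<and> card T = k + 2 - card F"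
    if "finite F" "F \<subseteq> V" for F
    by (rule ex_nset) (use V that in \<open>auto simp: card_Diff_subset\<close>)
  \<comment> \<open>Equivalently, \<open>D\<close> contains an even number of the edges of the cycle
    through \<open>a\<close>, \<open>c\<close>, \<open>b\<close>, \<open>d\<close> in this
    order.\<close>
  have four_cycle: "({a, c} \<in> D \<longleftrightarrow> {b, c} \<in> D) \<longleftrightarrow> ({a, d} \<in> D \<longleftrightarrow> {b, d} \<in> D)"
    if "{a, b, c, d} \<subseteq> V" and dist: "distinct [a, b, c, d]" for a b c d
  proof -
    obtain T where T: "T \<subseteq> V - {a, b, c, d}" "finite T" "card T = k - 2"
    proof -
      have "card {a, b, c, d} = 4" using dist by simp
      then show ?thesis
        using room[of "{a, b, c, d}"] \<open>{a, b, c, d} \<subseteq> V\<close> that by auto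
    qed
    \<comment> \<open>Each side is the parity of a degree into the \<open>(k-1)\<close>-set
      \<open>insert z T\<close>. Comparing \<open>z = c\<close> with \<open>z = d\<close> eliminates
      the degrees into \<open>T\<close>.\<close>
    have "(even (?deg T a) \<longleftrightarrow> {a, z} \<notin> D) \<longleftrightarrow> (even (?deg T b) \<longleftrightarrow> {b, z} \<notin> D)"
      if z: "z = c \<or> z = d" for z
    proof -
      have "z \<notin> T" using z T by auto
      then have "card (insert z T) = k - 1" using T k by simp
      then have "even (?deg (insert z T) a) \<longleftrightarrow> even (?deg (insert z T) b)"
        by (intro deg_eq) (use T z dist \<open>{a, b, c, d} \<subseteq> V\<close> in auto)
      then show ?thesis
        by (simp only: even_card_filter_insert[OF \<open>finite T\<close> \<open>z \<notin> T\<close>])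
    qed
    from this[of c] this[of d] show ?thesis by blast
  qed
  have agree: "{a, c} \<in> D \<longleftrightarrow> {b, c} \<in> D"
    if "{a, b, c} \<subseteq> V" and dist: "distinct [a, b, c]" for a b c
  proof (rule ccontr)
    assume c: "\<not> ?thesis"
    obtain S where S: "S \<subseteq> V - {a, b, c}" "finite S" "card S = k - 1"
    proof -
      have "card {a, b, c} = 3" using dist by simp
      then show ?thesis
        using room[of "{a, b, c}"] \<open>{a, b, c} \<subseteq> V\<close> that by auto
    qed
    \<comment> \<open>The disagreement at \<open>c\<close> spreads to all of \<open>S\<close>, so
      the neighbourhoods of \<open>a\<close> and \<open>b\<close> in \<open>S\<close> partition
      \<open>S\<close>.\<close>
    have neq: "{a, x} \<in> D \<longleftrightarrow> {b, x} \<notin> D" if "x \<in> S" for x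
      using four_cycle[of a b c x] c that S dist \<open>{a, b, c} \<subseteq> V\<close> by auto
    then have "{x \<in> S. {b, x} \<in> D} = S - {x \<in> S. {a, x} \<in> D}" by auto
    then have "?deg S a + ?deg S b = card S"
      using \<open>finite S\<close> by (simp add: card_Diff_subset card_mono)
    moreover have "even (?deg S a) \<longleftrightarrow> even (?deg S b)"
      by (rule deg_eq) (use S that in auto)
    then have "even (?deg S a + ?deg S b)" by simp
    ultimately have "even (card S)" by simp
    with S k show False by simp
  qed
  have "[V]\<^bsup>2\<^esup> \<subseteq> D" if "e \<in> D" for e
  proof
    fix e' assume "e' \<in> [V]\<^bsup>2\<^esup>"
    then obtain x y where xy: "e' = {x, y}" "x \<noteq> y" "x \<in> V" "y \<in> V"
      by (auto simp: nsets_def card_2_iff)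
    have "e \<in> [V]\<^bsup>2\<^esup>" using that D by auto
    then obtain p q where pq: "e = {p, q}" "p \<noteq> q" "p \<in> V" "q \<in> V"
      by (auto simp: nsets_def card_2_iff)
    \<comment> \<open>By \<open>agree\<close>, one end of an edge may be replaced while the other
      stays fixed. One replacement turns \<open>{p, q}\<close> into an edge at \<open>x\<close>, a
      second one moves its other end to \<open>y\<close>.\<close>
    have "\<exists>z \<in> V. z \<noteq> x \<and> {z, x} \<in> D"
    proof (cases "x = p \<or> x = q")
      case True
      with that pq show ?thesis by (metis insert_commute)
    next
      case False
      then have "{x, q} \<in> D"
        using agree[of x p q] that pq xy by simp
      with False pq show ?thesis by (metis insert_commute)
    qed
    then obtain z where z: "z \<in> V" "z \<noteq> x" "{z, x} \<in> D" by blast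
    have "{y, x} \<in> D"
    proof (cases "z = y")
      case False
      with agree[of y z x] z xy show ?thesis by simp
    qed (use z in simp)
    with xy show "e' \<in> D" by (simp add: insert_commute)
  qed
  with D show ?thesis by auto
qed

text \<open>The sum of the cardinalities of \<open>A\<close> and \<open>B\<close> exceeds that of
  their symmetric difference by twice that of \<open>A \<inter> B\<close>. This reduces a parity
  comparison of two graphs to one edge set.\<close>

lemma even_card_sym_diff:
  assumes "finite A" "finite B"
  shows "even (card (sym_diff A B)) \<longleftrightarrow> (even (card A) \<longleftrightarrow> even (card B))"
proof -
  have "card (sym_diff A B) = card (A - B) + card (B - A)"
    using assms by (intro card_Un_disjoint) auto
  moreover have "card A = card (A - B) + card (A \<inter> B)"
    using card_Int_Diff[of A B] assms by simp
  moreover have "card B = card (B - A) + card (A \<inter> B)"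
    using card_Int_Diff[of B A] assms by (simp add: Int_commute)
  ultimately show ?thesis by auto
qed

text \<open>The edges of the graph and of its complement inside \<open>K\<close> partition the pairs
  from \<open>K\<close>. For \<open>k = 4 * m\<close> there are \<open>2 * m * (4 * m - 1)\<close>
  pairs, an even number, so both parts have the same parity.\<close>

lemma even_edge_count_complement_iff:
  assumes G: "is_graph G" and K: "K \<in> [verts G]\<^bsup>k\<^esup>" and k: "k mod 4 = 0"
  shows "even (edge_count (induced_subgraph (complement_graph G) K))
    \<longleftrightarrow> even (edge_count (induced_subgraph G K))"
proof -
  let ?A = "{e \<in> edges G. e \<subseteq> K}"
  have fin: "finite K" and card: "card K = k" and sub: "K \<subseteq> verts G"
    using K by (auto simp: nsets_def)
  have A: "?A \<subseteq> [K]\<^bsup>2\<^esup>"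
    using G by (auto simp: is_graph_def nsets_def)
  have "{e \<in> [verts G]\<^bsup>2\<^esup> - edges G. e \<subseteq> K} = [K]\<^bsup>2\<^esup> - ?A"
    using sub by (auto simp: nsets_def)
  then have "edge_count (induced_subgraph (complement_graph G) K) = card ([K]\<^bsup>2\<^esup> - ?A)"
    by (simp add: edge_count_def induced_subgraph_def complement_graph_def)
  moreover have "card ([K]\<^bsup>2\<^esup> - ?A) + card ?A = k choose 2"
    using card_nsets[of K 2] card A finite_imp_finite_nsets[OF fin, of 2]
    by (metis (lifting) card_Diff_subset card_mono finite_subset le_add_diff_inverse2)
  moreover obtain m where "k = 4 * m" using k by auto
  then have "even (k choose 2)" by (simp add: choose_two)
  ultimately have "even (edge_count (induced_subgraph (complement_graph G) K) + card ?A)"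
    by simp
  then show ?thesis
    by (simp add: edge_count_def induced_subgraph_def)
qed

theorem theorem2p6:
  fixes V :: "'a set" and G G' :: "'a graph" and k :: nat
  assumes "is_graph G" and "is_graph G'"
    and "verts G = V" and "verts G' = V"
    and "k \<ge> 4" and "k mod 4 = 0"
    and "finite V \<longrightarrow> k + 2 \<le> card V"
  shows "(\<forall>K \<in> [V]\<^bsup>k\<^esup>.
            even (edge_count (induced_subgraph G K)) \<longleftrightarrow>
            even (edge_count (induced_subgraph G' K)))
         \<longleftrightarrow> (G' = G \<or> G' = complement_graph G)"
proof
  assume same: "\<forall>K \<in> [V]\<^bsup>k\<^esup>. even (edge_count (induced_subgraph G K)) \<longleftrightarrow>
            even (edge_count (induced_subgraph G' K))"
  let ?D = "sym_diff (edges G) (edges G')"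
  have E: "edges G \<subseteq> [V]\<^bsup>2\<^esup>" "edges G' \<subseteq> [V]\<^bsup>2\<^esup>"
    using assms by (auto simp: is_graph_def)
  have "?D = {} \<or> ?D = [V]\<^bsup>2\<^esup>"
  proof (rule even_induced_imp_empty_or_complete)
    fix K assume K: "K \<in> [V]\<^bsup>k\<^esup>"
    then have "finite K" by (auto simp: nsets_def)
    have split: "{e \<in> ?D. e \<subseteq> K} = sym_diff {e \<in> edges G. e \<subseteq> K} {e \<in> edges G'. e \<subseteq> K}"
      by auto
    show "even (card {e \<in> ?D. e \<subseteq> K})"
      unfolding split
      using bspec[OF same K] even_card_sym_diff[OF finite_edges_within[OF E(1) \<open>finite K\<close>]
        finite_edges_within[OF E(2) \<open>finite K\<close>]]
      by (simp add: edge_count_def induced_subgraph_def)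
  next
    show "even k" using assms(6) by presburger
  qed (use E assms in auto)
  \<comment> \<open>An empty \<open>?D\<close> gives equal edge sets, a complete one gives
    complementary edge sets.\<close>
  then have "edges G' = edges G \<or> edges G' = [V]\<^bsup>2\<^esup> - edges G"
    using E by blast
  with assms show "G' = G \<or> G' = complement_graph G"
    by (auto simp: complement_graph_def prod_eq_iff)
next
  assume "G' = G \<or> G' = complement_graph G"
  then show "\<forall>K \<in> [V]\<^bsup>k\<^esup>. even (edge_count (induced_subgraph G K)) \<longleftrightarrow>
            even (edge_count (induced_subgraph G' K))"
    using even_edge_count_complement_iff[OF assms(1) _ assms(6)] assms(3) by auto
qed

end
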